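(* Let $c\in(0,1)$ be a universal constant for which the Sudakov minoration bound stated in the context holds. Let $N\ge1$ be an integer, and let $(X_t)_{t\in\{-1,+1\}^N}$ be i.i.d. $\mathcal{N}(0,N/2)$ random variables. For $\beta\ge0$ let $Z_N(\beta)=\sum_{t\in\{-1,+1\}^N}e^{\beta X_t}$, $\nu_{N,\beta}(t)=e^{\beta X_t}/Z_N(\beta)$, and $P_N(\beta)=\frac1N\mathbf{E}\log Z_N(\beta)$. For each $\beta_0\ge0$ define the functions of $\beta \ge 0$ $$\underline{\mathcal{Q}}_N(\beta;\beta_0):=\begin{cases}\log2+\frac{c^2\beta^2}{8},&\beta\le\beta_0\\[2pt] \log2+\frac{c^2\beta_0^2}{8}+c(\beta-\beta_0)\sqrt{\frac{1}{2N}\mathbf{E} D(\nu_{N,\beta_0}\|\nu_{N,0})},&\beta\ge\beta_0\end{cases}$$ and $$\overline{\mathcal{Q}}_N(\beta;\beta_0):=\begin{cases}\log2+\frac{\beta^2}{4},&\beta\le\beta_0\\[2pt] \log2+\frac{\beta_0^2}{4}+(\beta-\beta_0)\sqrt{\frac1N\mathbf{E} D(\nu_{N,\beta}\|\nu_{N,0})},&\beta\ge\beta_0.\end{cases}$$ Then there exists an inverse temperature threshold $\beta_*=\beta_{N,*}>0$ such that, for all $\beta\ge0$, $$\underline{\mathcal{Q}}_N(\beta;\beta_* )\le P_N(\beta)\le\inf_{\beta_0\ge0}\overline{\mathcal{Q}}_N(\beta;\beta_0).$$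
   Context: This is the Random Energy Model (REM): $P_N(\beta)$ is the quenched pressure and $\nu_{N,\beta}$ is the (random) Gibbs measure on $\{-1,+1\}^N$ at inverse temperature $\beta$, with $\nu_{N,0}$ the uniform distribution. $D(\mu\|\nu)=\sum_t\mu(t)\log\frac{\mu(t)}{\nu(t)}$ is the Kullback–Leibler divergence (natural logarithm), and $\mathbf{E}$ is expectation with respect to $X$. Sudakov minoration (known result fixing the constant $c$): there is a universal constant $0<c<1$ such that for every finite index set $T$ with $|T|\ge2$ and every centered Gaussian process $(X_t)_{t\in T}$ with $(\mathbf{E}|X_s-X_t|^2)^{1/2}\ge a>0$ for all distinct $s,t\in T$, one has $\mathbf{E}[\max_{t\in T}X_t]\ge c\,a\sqrt{\log|T|}$. *)

theory Defs
  imports "HOL-Probability.Probability"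
begin

text \<open>The case distinction is needed because \<^term>\<open>normal_density 0 0\<close> is identically zero.\<close>

definition centered_gaussian :: "real \<Rightarrow> real measure" where
  "centered_gaussian \<sigma> =
     (if \<sigma> = 0 then return borel 0 else density lborel (normal_density 0 \<sigma>))"

definition centered_gaussian_process ::
    "'a measure \<Rightarrow> 'i set \<Rightarrow> ('i \<Rightarrow> 'a \<Rightarrow> real) \<Rightarrow> bool" where
  "centered_gaussian_process M T X \<longleftrightarrow>
     prob_space M \<and> (\<forall>t\<in>T. X t \<in> borel_measurable M) \<and>
     (\<forall>F u. finite F \<and> F \<subseteq> T \<longrightarrow>
        (\<exists>\<sigma>\<ge>0. distr M borel (\<lambda>\<omega>. \<Sum>t\<in>F. u t * X t \<omega>) = centered_gaussian \<sigma>))"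

text \<open>
  A definition cannot quantify over types, so the index sets are finite subsets of \<^typ>\<open>nat\<close>
  and the probability spaces live on \<^typ>\<open>nat \<Rightarrow> real\<close>. No generality is lost: the bound only
  involves the joint law of the process, and every finite process can be reindexed by natural
  numbers and realised, with the same law, by the coordinate maps on \<^typ>\<open>nat \<Rightarrow> real\<close>.
\<close>

definition sudakov_constant :: "real \<Rightarrow> bool" where
  "sudakov_constant c \<longleftrightarrow>
     (\<forall>(M :: (nat \<Rightarrow> real) measure) (T :: nat set) X a.
        finite T \<and> 2 \<le> card T \<and> centered_gaussian_process M T X \<and> 0 < a \<and>
        (\<forall>s\<in>T. \<forall>t\<in>T. s \<noteq> t \<longrightarrow> a \<le> sqrt (\<integral>\<omega>. \<bar>X s \<omega> - X t \<omega>\<bar>\<^sup>2 \<partial>M))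
        \<longrightarrow> c * a * sqrt (ln (real (card T))) \<le> (\<integral>\<omega>. Max ((\<lambda>t. X t \<omega>) ` T) \<partial>M))"

definition cube :: "nat \<Rightarrow> (nat \<Rightarrow> int) set" where
  "cube N = {..<N} \<rightarrow>\<^sub>E {-1, 1}"

definition rem_field :: "'a measure \<Rightarrow> nat \<Rightarrow> ((nat \<Rightarrow> int) \<Rightarrow> 'a \<Rightarrow> real) \<Rightarrow> bool" where
  "rem_field M N X \<longleftrightarrow>
     prob_space M \<and>
     prob_space.indep_vars M (\<lambda>_. borel) X (cube N) \<and>
     (\<forall>t\<in>cube N. distributed M lborel (X t) (normal_density 0 (sqrt (real N / 2))))"

definition partition_function ::
    "nat \<Rightarrow> ((nat \<Rightarrow> int) \<Rightarrow> 'a \<Rightarrow> real) \<Rightarrow> real \<Rightarrow> 'a \<Rightarrow> real" where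
  "partition_function N X \<beta> \<omega> = (\<Sum>t\<in>cube N. exp (\<beta> * X t \<omega>))"

definition gibbs ::
    "nat \<Rightarrow> ((nat \<Rightarrow> int) \<Rightarrow> 'a \<Rightarrow> real) \<Rightarrow> real \<Rightarrow> 'a \<Rightarrow> (nat \<Rightarrow> int) \<Rightarrow> real" where
  "gibbs N X \<beta> \<omega> t = exp (\<beta> * X t \<omega>) / partition_function N X \<beta> \<omega>"

definition pressure ::
    "'a measure \<Rightarrow> nat \<Rightarrow> ((nat \<Rightarrow> int) \<Rightarrow> 'a \<Rightarrow> real) \<Rightarrow> real \<Rightarrow> real" where
  "pressure M N X \<beta> = (\<integral>\<omega>. ln (partition_function N X \<beta> \<omega>) \<partial>M) / real N"

definition kl_div :: "'i set \<Rightarrow> ('i \<Rightarrow> real) \<Rightarrow> ('i \<Rightarrow> real) \<Rightarrow> real" where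
  "kl_div T \<mu> \<nu> = (\<Sum>t\<in>T. \<mu> t * ln (\<mu> t / \<nu> t))"

definition expected_kl ::
    "'a measure \<Rightarrow> nat \<Rightarrow> ((nat \<Rightarrow> int) \<Rightarrow> 'a \<Rightarrow> real) \<Rightarrow> real \<Rightarrow> real" where
  "expected_kl M N X \<beta> = (\<integral>\<omega>. kl_div (cube N) (gibbs N X \<beta> \<omega>) (gibbs N X 0 \<omega>) \<partial>M)"

text \<open>In both functions below, the two branches agree when the two inverse temperatures coincide.\<close>

definition Q_lower ::
    "real \<Rightarrow> 'a measure \<Rightarrow> nat \<Rightarrow> ((nat \<Rightarrow> int) \<Rightarrow> 'a \<Rightarrow> real) \<Rightarrow> real \<Rightarrow> real \<Rightarrow> real" where
  "Q_lower c M N X \<beta> \<beta>0 =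
     (if \<beta> \<le> \<beta>0 then ln 2 + c\<^sup>2 * \<beta>\<^sup>2 / 8
      else ln 2 + c\<^sup>2 * \<beta>0\<^sup>2 / 8
           + c * (\<beta> - \<beta>0) * sqrt (1 / (2 * real N) * expected_kl M N X \<beta>0))"

definition Q_upper ::
    "'a measure \<Rightarrow> nat \<Rightarrow> ((nat \<Rightarrow> int) \<Rightarrow> 'a \<Rightarrow> real) \<Rightarrow> real \<Rightarrow> real \<Rightarrow> real" where
  "Q_upper M N X \<beta> \<beta>0 =
     (if \<beta> \<le> \<beta>0 then ln 2 + \<beta>\<^sup>2 / 4
      else ln 2 + \<beta>0\<^sup>2 / 4 + (\<beta> - \<beta>0) * sqrt (1 / real N * expected_kl M N X \<beta>))"

end

theory Submission
  imports Defs
begin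

text \<open>
  Write \<open>P\<close> for the pressure, \<open>p(\<beta>)\<close> for the expected Gibbs mean of \<open>X\<close> divided by \<open>N\<close> (the slope
  of the convex function \<open>P\<close>), and \<open>D(\<beta>)\<close> for the expected divergence divided by \<open>N\<close>, so that
  \<open>D(\<beta>) = \<beta> p(\<beta>) - P(\<beta>) + ln 2\<close>. The tangent inequality \<open>P(\<gamma>) \<ge> P(\<beta>) + (\<gamma> - \<beta>) p(\<beta>)\<close> does all
  the work.

  Upper bound: with the annealed bound \<open>P(\<gamma>) \<le> ln 2 + \<gamma>\<^sup>2/4\<close> at \<open>\<gamma> = 2 p(\<beta>)\<close>, the tangent
  inequality gives \<open>p(\<beta>)\<^sup>2 \<le> D(\<beta>)\<close>, and at \<open>\<gamma> = \<beta>0\<close> it gives the claim.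

  Lower bound: any \<open>\<beta>s > 0\<close> works for which \<open>P(\<beta>) \<ge> ln 2 + c\<^sup>2\<beta>\<^sup>2/8\<close> on \<open>[0, \<beta>s]\<close>. Indeed
  then \<open>c\<^sup>2 D(\<beta>s)/2 \<le> c\<^sup>2 (\<beta>s p(\<beta>s) - c\<^sup>2\<beta>s\<^sup>2/8)/2 = p(\<beta>s)\<^sup>2 - (p(\<beta>s) - c\<^sup>2\<beta>s/4)\<^sup>2\<close>, so
  \<open>p(\<beta>s) \<ge> c sqrt (D(\<beta>s)/2)\<close>, and the tangent at \<open>\<beta>s\<close> lies below \<open>P\<close>. A small \<open>\<beta>s\<close> exists for
  every \<open>c < 1\<close>, since \<open>P(\<beta>) = ln 2 + (1 - 2\<^sup>-\<^sup>N) \<beta>\<^sup>2/4 + o(\<beta>\<^sup>2)\<close> and \<open>1 - 2\<^sup>-\<^sup>N \<ge> 1/2\<close>.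
\<close>

section \<open>Elementary inequalities for \<open>cosh\<close> and \<open>ln\<close>\<close>

lemma cosh_ge_quadratic:
  fixes x :: real
  shows "1 + x\<^sup>2 / 2 \<le> cosh x"
proof -
  have *: "u \<le> sinh u" if "0 \<le> u" for u :: real
  proof -
    have "(\<lambda>v. sinh v - v) 0 \<le> (\<lambda>v. sinh v - v) u"
      by (rule DERIV_nonneg_imp_nondecreasing[OF that])
         (auto intro!: derivative_eq_intros simp: cosh_real_ge_1)
    then show ?thesis by simp
  qed
  have "\<bar>x / 2\<bar> \<le> \<bar>sinh (x / 2)\<bar>"
    using *[of "x / 2"] *[of "- (x / 2)"] by (cases "0 \<le> x") auto
  then have "(x / 2)\<^sup>2 \<le> (sinh (x / 2))\<^sup>2"
    by (simp only: abs_le_square_iff)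
  moreover have "cosh x = 1 + 2 * (sinh (x / 2))\<^sup>2"
    using cosh_double[of "x / 2"] cosh_square_eq[of "x / 2"] by simp
  ultimately show ?thesis by (simp add: power_divide)
qed

text \<open>Beyond \<open>y = 1\<close> the left side is negative and the logarithm positive, which
  frees the usual bound from the restriction to [0, 1]; unbounded Gaussian arguments require
  this.\<close>

lemma ln_one_plus_lower_bound:
  fixes y :: real
  assumes "0 \<le> y"
  shows "y - y\<^sup>2 \<le> ln (1 + y)"
proof (cases "y \<le> 1")
  case True
  then show ?thesis using assms by (rule ln_one_plus_pos_lower_bound[rotated])
next
  case False
  then have "y * 1 \<le> y * y" by (intro mult_left_mono) auto
  moreover have "0 \<le> ln (1 + y)" using False by simp
  ultimately show ?thesis by (simp add: power2_eq_square)
qed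

lemma ln_cosh_lower_bound:
  fixes x :: real
  shows "x\<^sup>2 / 2 - x ^ 4 / 4 \<le> ln (cosh x)"
proof -
  have "x\<^sup>2 / 2 - (x\<^sup>2 / 2)\<^sup>2 \<le> ln (1 + x\<^sup>2 / 2)"
    by (rule ln_one_plus_lower_bound) simp
  also have "\<dots> \<le> ln (cosh x)"
    using cosh_ge_quadratic[of x] by (intro ln_mono) (auto intro: add_pos_nonneg)
  finally show ?thesis by (simp add: power_divide flip: power_mult)
qed

text \<open>Factoring out \<open>exp ((a + b) / 2)\<close> leaves \<open>cosh ((a - b) / 2)\<close>.
  The Jensen gap of a pair is thus bounded below by a polynomial, whose Gaussian expectation is
  explicit.\<close>

lemma ln_mean_exp_lower_bound:
  fixes a b :: real
  shows "(a + b) / 2 + (a - b)\<^sup>2 / 8 - (a - b) ^ 4 / 64 \<le> ln ((exp a + exp b) / 2)"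
proof -
  have "(exp a + exp b) / 2 = exp ((a + b) / 2) * cosh ((a - b) / 2)"
    by (simp add: cosh_field_def distrib_left field_simps flip: exp_add)
  then have "ln ((exp a + exp b) / 2) = (a + b) / 2 + ln (cosh ((a - b) / 2))"
    by (simp add: ln_mult_pos)
  then show ?thesis
    using ln_cosh_lower_bound[of "(a - b) / 2"] by (simp add: power_divide)
qed

lemma ln_le_tangent:
  fixes x a :: real
  assumes "0 < x" "0 < a"
  shows "ln x \<le> ln a + x / a - 1"
  using ln_le_minus_one[of "x / a"] assms by (simp add: ln_div)

text \<open>Jensen's inequality: when the tangent to \<open>ln\<close> at the mean is summed, its
  non-constant terms cancel.\<close>

lemma sum_ln_le_ln_mean:
  fixes y :: "'i \<Rightarrow> real"
  assumes "finite T" "T \<noteq> {}" and pos: "\<And>t. t \<in> T \<Longrightarrow> 0 < y t"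
  shows "(\<Sum>t\<in>T. ln (y t)) \<le> real (card T) * ln ((\<Sum>t\<in>T. y t) / real (card T))"
proof -
  define A where "A = (\<Sum>t\<in>T. y t) / real (card T)"
  have cT: "0 < real (card T)" using assms by (simp add: card_gt_0_iff)
  have s: "0 < (\<Sum>t\<in>T. y t)" by (rule sum_pos) (use assms in auto)
  then have A: "0 < A" using cT by (simp add: A_def)
  have "(\<Sum>t\<in>T. ln (y t)) \<le> (\<Sum>t\<in>T. ln A + y t / A - 1)"
    by (intro sum_mono ln_le_tangent pos A)
  also have "\<dots> = real (card T) * ln A + (\<Sum>t\<in>T. y t) / A - real (card T)"
    by (simp add: sum.distrib sum_subtractf sum_divide_distrib)
  also have "(\<Sum>t\<in>T. y t) / A = real (card T)"
    using s cT by (simp add: A_def)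
  finally show ?thesis by (simp add: A_def)
qed

section \<open>The cube and its pairing by a flip\<close>

lemma finite_cube [simp]: "finite (cube N)"
  by (simp add: cube_def finite_PiE)

lemma card_cube: "card (cube N) = 2 ^ N"
  by (simp add: cube_def card_PiE numeral_2_eq_2)

lemma cube_nonempty [simp]: "cube N \<noteq> {}"
  using card_cube[of N] by auto

text \<open>For \<open>1 \<le> N\<close> coordinate 0 exists, and this is a fixed-point-free
  involution of the cube.\<close>

definition flip :: "(nat \<Rightarrow> int) \<Rightarrow> nat \<Rightarrow> int" where
  "flip t = t(0 := - t 0)"

lemma flip_flip: "flip (flip t) = t"
  by (simp add: flip_def)

lemma flip_in_cube: "1 \<le> N \<Longrightarrow> t \<in> cube N \<Longrightarrow> flip t \<in> cube N"
  by (fastforce simp: flip_def cube_def PiE_iff extensional_def)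

lemma flip_neq: "1 \<le> N \<Longrightarrow> t \<in> cube N \<Longrightarrow> flip t \<noteq> t"
  by (auto simp: flip_def cube_def PiE_iff fun_upd_idem_iff dest!: bspec[of _ _ 0])

lemma sum_cube_flip: "1 \<le> N \<Longrightarrow> (\<Sum>t\<in>cube N. f (flip t)) = (\<Sum>t\<in>cube N. f t)"
  by (rule sum.reindex_bij_witness[of _ flip flip]) (simp_all add: flip_flip flip_in_cube)

section \<open>Pathwise identities and bounds for the Gibbs measure\<close>

definition gibbs_mean :: "nat \<Rightarrow> ((nat \<Rightarrow> int) \<Rightarrow> 'a \<Rightarrow> real) \<Rightarrow> real \<Rightarrow> 'a \<Rightarrow> real" where
  "gibbs_mean N X \<beta> \<omega> = (\<Sum>t\<in>cube N. gibbs N X \<beta> \<omega> t * X t \<omega>)"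

lemma partition_function_pos: "0 < partition_function N X \<beta> \<omega>"
  by (simp add: partition_function_def sum_pos)

lemma partition_function_nonzero [simp]: "partition_function N X \<beta> \<omega> \<noteq> 0"
  using partition_function_pos[of N X \<beta> \<omega>] by simp

lemma partition_function_0: "partition_function N X 0 \<omega> = 2 ^ N"
  by (simp add: partition_function_def card_cube)

lemma gibbs_pos: "0 < gibbs N X \<beta> \<omega> t"
  by (simp add: gibbs_def partition_function_pos)

lemma sum_gibbs: "(\<Sum>t\<in>cube N. gibbs N X \<beta> \<omega> t) = 1"
  using partition_function_pos[of N X \<beta> \<omega>]
  by (simp add: gibbs_def partition_function_def flip: sum_divide_distrib)

text \<open>The ratio of the partition functions at \<gamma> and \<beta> is the Gibbs average at
  \<beta> of \<open>exp ((\<gamma> - \<beta>) * X t \<omega>)\<close>, so Jensen's inequality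
  applies.\<close>

lemma ln_partition_function_tangent:
  "ln (partition_function N X \<beta> \<omega>) + (\<gamma> - \<beta>) * gibbs_mean N X \<beta> \<omega>
     \<le> ln (partition_function N X \<gamma> \<omega>)"
proof -
  let ?Z = "partition_function N X" and ?g = "gibbs N X \<beta> \<omega>"
  define m where "m = (\<gamma> - \<beta>) * gibbs_mean N X \<beta> \<omega>"
  have mean: "(\<Sum>t\<in>cube N. ?g t * ((\<gamma> - \<beta>) * X t \<omega>)) = m"
    by (simp add: m_def gibbs_mean_def sum_distrib_left mult_ac)
  \<comment> \<open>\<open>exp m\<close> becomes the Gibbs average of the tangent to
    \<open>exp\<close> at the mean \<open>m\<close>, ready for \<open>1 + x \<le> exp x\<close> in
    each term.\<close>
  have "exp m = (\<Sum>t\<in>cube N. ?g t) * (exp m * (1 - m)) + exp m * m"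
    by (simp add: sum_gibbs algebra_simps)
  also have "\<dots> = (\<Sum>t\<in>cube N. ?g t) * (exp m * (1 - m))
      + exp m * (\<Sum>t\<in>cube N. ?g t * ((\<gamma> - \<beta>) * X t \<omega>))"
    by (simp only: mean)
  also have "\<dots> = (\<Sum>t\<in>cube N. ?g t * (exp m * (1 + ((\<gamma> - \<beta>) * X t \<omega> - m))))"
    by (simp add: sum_distrib_left sum_distrib_right algebra_simps sum.distrib sum_subtractf)
  also have "\<dots> \<le> (\<Sum>t\<in>cube N. ?g t * (exp m * exp ((\<gamma> - \<beta>) * X t \<omega> - m)))"
    by (intro sum_mono mult_left_mono exp_ge_add_one_self) (simp_all add: gibbs_pos less_imp_le)
  also have "\<dots> = (\<Sum>t\<in>cube N. exp (\<gamma> * X t \<omega>) / ?Z \<beta> \<omega>)"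
    by (simp add: gibbs_def algebra_simps flip: exp_add)
  also have "\<dots> = ?Z \<gamma> \<omega> / ?Z \<beta> \<omega>"
    by (simp add: partition_function_def flip: sum_divide_distrib)
  finally have "exp m * ?Z \<beta> \<omega> \<le> ?Z \<gamma> \<omega>"
    by (simp add: pos_le_divide_eq partition_function_pos)
  then have "ln (exp m * ?Z \<beta> \<omega>) \<le> ln (?Z \<gamma> \<omega>)"
    by (intro ln_mono) (simp_all add: partition_function_pos)
  then show ?thesis
    by (simp add: m_def ln_mult_pos partition_function_pos add.commute)
qed

text \<open>The reference measure has constant mass \<open>1 / 2 ^ N\<close>, so the log-ratio is
  affine in \<open>X t \<omega>\<close> and averages to the Gibbs mean plus constants.\<close>

lemma kl_div_gibbs:
  "kl_div (cube N) (gibbs N X \<beta> \<omega>) (gibbs N X 0 \<omega>)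
     = \<beta> * gibbs_mean N X \<beta> \<omega> - ln (partition_function N X \<beta> \<omega>) + real N * ln 2"
proof -
  let ?g = "gibbs N X \<beta> \<omega>" and ?Z = "partition_function N X \<beta> \<omega>"
  have "?g t / gibbs N X 0 \<omega> t = exp (\<beta> * X t \<omega>) / ?Z * 2 ^ N" for t
    by (simp add: gibbs_def partition_function_0)
  then have "ln (?g t / gibbs N X 0 \<omega> t) = \<beta> * X t \<omega> - ln ?Z + real N * ln 2" for t
    by (simp add: ln_mult_pos ln_div partition_function_pos ln_realpow)
  then have "kl_div (cube N) ?g (gibbs N X 0 \<omega>)
      = (\<Sum>t\<in>cube N. ?g t * (\<beta> * X t \<omega>) + ?g t * (real N * ln 2 - ln ?Z))"
    unfolding kl_div_def by (simp only:) (simp add: algebra_simps)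
  also have "\<dots> = \<beta> * gibbs_mean N X \<beta> \<omega> + (\<Sum>t\<in>cube N. ?g t) * (real N * ln 2 - ln ?Z)"
    by (simp add: sum.distrib gibbs_mean_def sum_distrib_left sum_distrib_right mult_ac)
  finally show ?thesis by (simp add: sum_gibbs)
qed

lemma abs_gibbs_mean_le: "\<bar>gibbs_mean N X \<beta> \<omega>\<bar> \<le> (\<Sum>t\<in>cube N. \<bar>X t \<omega>\<bar>)"
proof -
  have "gibbs N X \<beta> \<omega> t \<le> 1" if "t \<in> cube N" for t
    using member_le_sum[of t "cube N" "gibbs N X \<beta> \<omega>"] that
    by (simp add: sum_gibbs gibbs_pos less_imp_le)
  then have "\<bar>gibbs N X \<beta> \<omega> t * X t \<omega>\<bar> \<le> \<bar>X t \<omega>\<bar>" if "t \<in> cube N" for t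
    using that gibbs_pos[of N X \<beta> \<omega> t] by (simp add: abs_mult mult_left_le_one_le)
  then show ?thesis
    unfolding gibbs_mean_def by (intro order_trans[OF sum_abs] sum_mono)
qed

text \<open>The tangent at 0 bounds the logarithm below, the tangent at \<beta> bounds it above. The
  result serves as an integrable majorant.\<close>

lemma abs_ln_partition_function_le:
  "\<bar>ln (partition_function N X \<beta> \<omega>)\<bar> \<le> real N * ln 2 + \<bar>\<beta>\<bar> * (\<Sum>t\<in>cube N. \<bar>X t \<omega>\<bar>)"
proof -
  have bound: "\<bar>\<beta> * gibbs_mean N X \<gamma> \<omega>\<bar> \<le> \<bar>\<beta>\<bar> * (\<Sum>t\<in>cube N. \<bar>X t \<omega>\<bar>)" for \<gamma>
    by (simp add: abs_mult mult_left_mono abs_gibbs_mean_le)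
  have "real N * ln 2 + \<beta> * gibbs_mean N X 0 \<omega> \<le> ln (partition_function N X \<beta> \<omega>)"
    "ln (partition_function N X \<beta> \<omega>) - \<beta> * gibbs_mean N X \<beta> \<omega> \<le> real N * ln 2"
    using ln_partition_function_tangent[of N X 0 \<omega> \<beta>] ln_partition_function_tangent[of N X \<beta> \<omega> 0]
    by (simp_all add: partition_function_0 ln_realpow)
  moreover have "0 \<le> real N * ln 2" by simp
  ultimately show ?thesis
    using bound[of 0] bound[of \<beta>] by linarith
qed

text \<open>Pairing each configuration with its flip and applying concavity of \<open>ln\<close> to the pair
  averages keeps at least half of the curvature of \<open>P\<close> at \<open>0\<close>, which is all that \<open>c < 1\<close> requires.\<close>
lemma ln_partition_function_flip_lower_bound:
  assumes "1 \<le> N"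
  shows "real N * ln 2 + (\<Sum>t\<in>cube N. \<beta> * X t \<omega> + \<beta>\<^sup>2 / 8 * (X t \<omega> - X (flip t) \<omega>)\<^sup>2
            - \<beta> ^ 4 / 64 * (X t \<omega> - X (flip t) \<omega>) ^ 4) / 2 ^ N
         \<le> ln (partition_function N X \<beta> \<omega>)"
proof -
  let ?Z = "partition_function N X \<beta> \<omega>"
  define y where "y t = (exp (\<beta> * X t \<omega>) + exp (\<beta> * X (flip t) \<omega>)) / 2" for t
  \<comment> \<open>The flip permutes the cube, so each linear term may be replaced by the average
    over its pair.\<close>
  have "(\<Sum>t\<in>cube N. \<beta> * X t \<omega> + \<beta>\<^sup>2 / 8 * (X t \<omega> - X (flip t) \<omega>)\<^sup>2
            - \<beta> ^ 4 / 64 * (X t \<omega> - X (flip t) \<omega>) ^ 4)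
      = (\<Sum>t\<in>cube N. (\<beta> * X t \<omega> + \<beta> * X (flip t) \<omega>) / 2
          + (\<beta> * X t \<omega> - \<beta> * X (flip t) \<omega>)\<^sup>2 / 8 - (\<beta> * X t \<omega> - \<beta> * X (flip t) \<omega>) ^ 4 / 64)"
    by (simp add: sum.distrib sum_subtractf add_divide_distrib power_mult_distrib
          sum_cube_flip[OF assms, of "\<lambda>t. \<beta> * X t \<omega> / 2"] flip: right_diff_distrib)
       (simp flip: sum_divide_distrib)
  also have "\<dots> \<le> (\<Sum>t\<in>cube N. ln (y t))"
    unfolding y_def by (intro sum_mono ln_mean_exp_lower_bound)
  also have "\<dots> \<le> real (card (cube N)) * ln ((\<Sum>t\<in>cube N. y t) / real (card (cube N)))"
    by (rule sum_ln_le_ln_mean) (simp_all add: y_def add_pos_pos)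
  also have "(\<Sum>t\<in>cube N. y t) = ?Z"
    using sum_cube_flip[OF assms, of "\<lambda>t. exp (\<beta> * X t \<omega>)"]
    by (simp add: y_def partition_function_def sum.distrib flip: sum_divide_distrib)
  also have "ln (?Z / real (card (cube N))) = ln ?Z - real N * ln 2"
    by (simp add: card_cube ln_div partition_function_pos ln_realpow)
  finally show ?thesis
    by (simp add: card_cube field_simps)
qed

section \<open>Gaussian moments and pairwise independence\<close>

context prob_space
begin

lemma normal_distributed_central_moment:
  assumes "0 < \<sigma>" and D: "distributed M lborel Y (normal_density 0 \<sigma>)"
  shows "integrable M (\<lambda>\<omega>. Y \<omega> ^ k)"
    and "expectation (\<lambda>\<omega>. Y \<omega> ^ (2 * k)) = fact (2 * k) / ((2 / \<sigma>\<^sup>2) ^ k * fact k)"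
  using integrable_normal_moment[OF assms(1), of 0 k] integral_normal_moment_even[OF assms(1), of 0 k]
    distributed_integrable[OF D, of "\<lambda>x. x ^ k"] distributed_integral[OF D, of "\<lambda>x. x ^ (2 * k)"]
  by simp_all

text \<open>Completing the square turns the exponentially tilted density into a multiple of a
  shifted normal density.\<close>

lemma normal_distributed_exp:
  assumes "0 < \<sigma>" and D: "distributed M lborel Y (normal_density 0 \<sigma>)"
  shows "integrable M (\<lambda>\<omega>. exp (\<beta> * Y \<omega>))"
    and "expectation (\<lambda>\<omega>. exp (\<beta> * Y \<omega>)) = exp (\<sigma>\<^sup>2 * \<beta>\<^sup>2 / 2)"
proof -
  have "normal_density 0 \<sigma> x * exp (\<beta> * x)
      = exp (\<sigma>\<^sup>2 * \<beta>\<^sup>2 / 2) * normal_density (\<beta> * \<sigma>\<^sup>2) \<sigma> x" for x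
  proof -
    have "- x\<^sup>2 / (2 * \<sigma>\<^sup>2) + \<beta> * x = \<sigma>\<^sup>2 * \<beta>\<^sup>2 / 2 + - (x - \<beta> * \<sigma>\<^sup>2)\<^sup>2 / (2 * \<sigma>\<^sup>2)"
      using assms(1) by (simp add: field_simps power2_eq_square)
    then show ?thesis
      by (simp add: normal_density_def flip: exp_add)
  qed
  then have *: "(\<lambda>x. normal_density 0 \<sigma> x * exp (\<beta> * x))
      = (\<lambda>x. exp (\<sigma>\<^sup>2 * \<beta>\<^sup>2 / 2) * normal_density (\<beta> * \<sigma>\<^sup>2) \<sigma> x)"
    by auto
  show "integrable M (\<lambda>\<omega>. exp (\<beta> * Y \<omega>))"
    using distributed_integrable[OF D, of "\<lambda>x. exp (\<beta> * x)"] assms(1) by (simp add: *)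
  show "expectation (\<lambda>\<omega>. exp (\<beta> * Y \<omega>)) = exp (\<sigma>\<^sup>2 * \<beta>\<^sup>2 / 2)"
    using distributed_integral[OF D, of "\<lambda>x. exp (\<beta> * x)"] assms(1) by (simp add: *)
qed

text \<open>Independence of \<open>X s\<close> from a sum over the singleton
  \<open>{t}\<close>.\<close>

lemma indep_vars_imp_indep_var:
  fixes X :: "'i \<Rightarrow> 'a \<Rightarrow> real"
  assumes "indep_vars (\<lambda>_. borel) X I" "s \<in> I" "t \<in> I" "s \<noteq> t"
  shows "indep_var borel (X s) borel (X t)"
  using indep_vars_sum[of "{t}" s X] indep_vars_subset[OF assms(1), of "{s, t}"] assms by simp

end

section \<open>Moments, measurability and integrability in the REM\<close>

locale rem = prob_space M for M :: "'a measure" +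
  fixes N :: nat and X :: "(nat \<Rightarrow> int) \<Rightarrow> 'a \<Rightarrow> real"
  assumes N_ge_1: "1 \<le> N" and rem_field: "rem_field M N X"
begin

lemma N_pos: "0 < real N"
  using N_ge_1 by simp

lemma X_distributed: "t \<in> cube N \<Longrightarrow> distributed M lborel (X t) (normal_density 0 (sqrt (real N / 2)))"
  using rem_field by (simp add: rem_field_def)

lemma X_measurable [measurable]: "t \<in> cube N \<Longrightarrow> X t \<in> borel_measurable M"
  using distributed_measurable[OF X_distributed] by simp

lemma X_integrable: "t \<in> cube N \<Longrightarrow> integrable M (X t)"
  using normal_distributed_central_moment(1)[OF _ X_distributed, of t 1] N_pos by simp

lemma expectation_X: "t \<in> cube N \<Longrightarrow> expectation (X t) = 0"
  using normal_distributed_expectation[OF _ X_distributed, of t] N_pos by simp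

text \<open>By independence the two variances \<open>N / 2\<close> add up to
  \<open>N\<close>.\<close>

lemma difference_distributed:
  assumes "s \<in> cube N" "t \<in> cube N" "s \<noteq> t"
  shows "distributed M lborel (\<lambda>\<omega>. X s \<omega> - X t \<omega>) (normal_density 0 (sqrt (real N)))"
proof -
  have "indep_vars (\<lambda>_. borel) X (cube N)"
    using rem_field by (simp add: rem_field_def)
  then have "indep_var borel (X s) borel (X t)"
    using assms by (rule indep_vars_imp_indep_var)
  from diff_indep_normal[OF this _ _ X_distributed X_distributed, OF _ _ assms(1,2)] N_pos
  show ?thesis by simp
qed

lemma expectation_difference_powers:
  assumes "s \<in> cube N" "t \<in> cube N" "s \<noteq> t"
  shows "integrable M (\<lambda>\<omega>. (X s \<omega> - X t \<omega>) ^ k)"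
    and "expectation (\<lambda>\<omega>. (X s \<omega> - X t \<omega>)\<^sup>2) = real N"
    and "expectation (\<lambda>\<omega>. (X s \<omega> - X t \<omega>) ^ 4) = 3 * (real N)\<^sup>2"
  using normal_distributed_central_moment(1)[OF _ difference_distributed[OF assms], of k]
    normal_distributed_central_moment(2)[OF _ difference_distributed[OF assms], of 1]
    normal_distributed_central_moment(2)[OF _ difference_distributed[OF assms], of 2] N_pos
  by (simp_all add: fact_numeral power_divide)

lemma partition_function_measurable [measurable]: "partition_function N X \<beta> \<in> borel_measurable M"
  unfolding partition_function_def[abs_def] by measurable

lemma gibbs_mean_measurable [measurable]: "gibbs_mean N X \<beta> \<in> borel_measurable M"
  unfolding gibbs_mean_def[abs_def] gibbs_def[abs_def] by measurable

lemma gibbs_mean_integrable: "integrable M (gibbs_mean N X \<beta>)"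
proof (rule Bochner_Integration.integrable_bound)
  show "integrable M (\<lambda>\<omega>. \<Sum>t\<in>cube N. \<bar>X t \<omega>\<bar>)"
    by (intro Bochner_Integration.integrable_sum integrable_abs X_integrable)
  show "AE \<omega> in M. norm (gibbs_mean N X \<beta> \<omega>) \<le> norm (\<Sum>t\<in>cube N. \<bar>X t \<omega>\<bar>)"
    using abs_gibbs_mean_le[of N X \<beta>] by (auto intro: order_trans[OF _ abs_ge_self])
qed measurable

lemma ln_partition_function_integrable: "integrable M (\<lambda>\<omega>. ln (partition_function N X \<beta> \<omega>))"
proof (rule Bochner_Integration.integrable_bound)
  show "integrable M (\<lambda>\<omega>. real N * ln 2 + \<bar>\<beta>\<bar> * (\<Sum>t\<in>cube N. \<bar>X t \<omega>\<bar>))"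
    by (intro Bochner_Integration.integrable_add integrable_const integrable_mult_right
          Bochner_Integration.integrable_sum integrable_abs X_integrable)
  show "AE \<omega> in M. norm (ln (partition_function N X \<beta> \<omega>))
      \<le> norm (real N * ln 2 + \<bar>\<beta>\<bar> * (\<Sum>t\<in>cube N. \<bar>X t \<omega>\<bar>))"
    using abs_ln_partition_function_le[of N X \<beta>]
    by (auto intro: order_trans[OF _ abs_ge_self])
qed measurable

section \<open>Convexity and two-sided bounds of the pressure\<close>

text \<open>Given as an expectation, it is a subgradient of the pressure by
  \<open>pressure_tangent\<close>, with no differentiation under the integral.\<close>

definition slope :: "real \<Rightarrow> real" where
  "slope \<beta> = expectation (gibbs_mean N X \<beta>) / real N"

lemma pressure_0: "pressure M N X 0 = ln 2"
  using N_pos by (simp add: pressure_def partition_function_0 ln_realpow prob_space)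

lemma pressure_tangent: "pressure M N X \<beta> + (\<gamma> - \<beta>) * slope \<beta> \<le> pressure M N X \<gamma>"
proof -
  have "(\<integral>\<omega>. ln (partition_function N X \<beta> \<omega>) + (\<gamma> - \<beta>) * gibbs_mean N X \<beta> \<omega> \<partial>M)
      \<le> (\<integral>\<omega>. ln (partition_function N X \<gamma> \<omega>) \<partial>M)"
    by (intro integral_mono ln_partition_function_tangent Bochner_Integration.integrable_add
          ln_partition_function_integrable integrable_mult_right gibbs_mean_integrable)
  then show ?thesis
    using N_pos
    by (simp add: pressure_def slope_def ln_partition_function_integrable gibbs_mean_integrable
          pos_le_divide_eq distrib_right)
qed

lemma expected_kl_eq: "expected_kl M N X \<beta> / real N = \<beta> * slope \<beta> - pressure M N X \<beta> + ln 2"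
  using N_pos
  by (simp add: expected_kl_def kl_div_gibbs ln_partition_function_integrable gibbs_mean_integrable
        slope_def pressure_def prob_space field_simps)

lemma slope_nonneg:
  assumes "0 < \<beta>" and "ln 2 \<le> pressure M N X \<beta>"
  shows "0 \<le> slope \<beta>"
proof -
  have "0 \<le> \<beta> * slope \<beta>"
    using pressure_tangent[of \<beta> 0] assms(2) by (simp add: pressure_0)
  then show ?thesis using assms(1) by (simp add: zero_le_mult_iff)
qed

lemma pressure_le: "pressure M N X \<beta> \<le> ln 2 + \<beta>\<^sup>2 / 4"
proof -
  define A where "A = 2 ^ N * exp (real N * \<beta>\<^sup>2 / 4)"
  have A: "0 < A" by (simp add: A_def)
  have ex: "integrable M (\<lambda>\<omega>. exp (\<beta> * X t \<omega>))"
      "expectation (\<lambda>\<omega>. exp (\<beta> * X t \<omega>)) = exp (real N * \<beta>\<^sup>2 / 4)" if "t \<in> cube N" for t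
    using normal_distributed_exp[OF _ X_distributed[OF that], of \<beta>] N_pos by simp_all
  have int: "integrable M (partition_function N X \<beta>)"
    unfolding partition_function_def[abs_def]
    by (intro Bochner_Integration.integrable_sum ex)
  have mean: "expectation (partition_function N X \<beta>) = A"
    unfolding partition_function_def[abs_def]
    by (simp add: ex A_def card_cube)
  \<comment> \<open>Jensen's inequality via the tangent to \<open>ln\<close> at \<open>A\<close>,
    the expectation of the partition function; the excess has mean zero.\<close>
  have "expectation (\<lambda>\<omega>. ln (partition_function N X \<beta> \<omega>))
      \<le> expectation (\<lambda>\<omega>. ln A + partition_function N X \<beta> \<omega> / A - 1)"
    using A by (intro integral_mono ln_le_tangent ln_partition_function_integrable
        Bochner_Integration.integrable_add Bochner_Integration.integrable_diff
        integrable_const integrable_divide_zero impI int partition_function_pos)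
  also have "\<dots> = ln A"
    using A by (simp add: int mean prob_space)
  also have "\<dots> = real N * (ln 2 + \<beta>\<^sup>2 / 4)"
    by (simp add: A_def ln_mult_pos ln_realpow distrib_left)
  finally show ?thesis
    using N_pos by (simp add: pressure_def pos_divide_le_eq mult.commute)
qed

text \<open>Expectation of the flip bound: the linear terms vanish, and each pair difference has
  second moment \<open>N\<close> and fourth moment \<open>3 * N\<^sup>2\<close>.\<close>

lemma pressure_ge:
  "ln 2 + \<beta>\<^sup>2 / 8 - 3 * real N * \<beta> ^ 4 / 64 \<le> pressure M N X \<beta>"
proof -
  have flip: "flip t \<in> cube N" "t \<noteq> flip t" if "t \<in> cube N" for t
    using flip_in_cube[OF N_ge_1 that] flip_neq[OF N_ge_1 that] by auto
  note [simp] = X_integrable expectation_X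
    expectation_difference_powers[OF _ flip]
  have "expectation (\<lambda>\<omega>. real N * ln 2 + (\<Sum>t\<in>cube N. \<beta> * X t \<omega>
          + \<beta>\<^sup>2 / 8 * (X t \<omega> - X (flip t) \<omega>)\<^sup>2 - \<beta> ^ 4 / 64 * (X t \<omega> - X (flip t) \<omega>) ^ 4) / 2 ^ N)
      \<le> expectation (\<lambda>\<omega>. ln (partition_function N X \<beta> \<omega>))"
    by (intro integral_mono ln_partition_function_flip_lower_bound N_ge_1
        ln_partition_function_integrable) simp
  also have "expectation (\<lambda>\<omega>. real N * ln 2 + (\<Sum>t\<in>cube N. \<beta> * X t \<omega>
          + \<beta>\<^sup>2 / 8 * (X t \<omega> - X (flip t) \<omega>)\<^sup>2 - \<beta> ^ 4 / 64 * (X t \<omega> - X (flip t) \<omega>) ^ 4) / 2 ^ N)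
      = real N * ln 2 + (\<beta>\<^sup>2 / 8 * real N - \<beta> ^ 4 / 64 * (3 * (real N)\<^sup>2))"
    by (simp add: card_cube prob_space)
  also have "\<dots> = (ln 2 + \<beta>\<^sup>2 / 8 - 3 * real N * \<beta> ^ 4 / 64) * real N"
    by (simp add: field_simps power2_eq_square)
  finally show ?thesis
    using N_pos by (simp add: pressure_def pos_le_divide_eq)
qed

section \<open>Comparison of slope and divergence, and the threshold\<close>

lemma slope_le_sqrt_expected_kl: "slope \<beta> \<le> sqrt (expected_kl M N X \<beta> / real N)"
proof (rule real_le_rsqrt)
  show "(slope \<beta>)\<^sup>2 \<le> expected_kl M N X \<beta> / real N"
    \<comment> \<open>The point \<open>2 * slope \<beta>\<close> maximises
      \<open>\<gamma> * slope \<beta> - \<gamma>\<^sup>2 / 4\<close>, with maximum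
      \<open>(slope \<beta>)\<^sup>2\<close>.\<close>
    using pressure_tangent[of \<beta> "2 * slope \<beta>"] pressure_le[of "2 * slope \<beta>"]
    by (simp add: expected_kl_eq power2_eq_square algebra_simps)
qed

lemma pressure_le_Q_upper:
  assumes "0 \<le> \<beta>0"
  shows "pressure M N X \<beta> \<le> Q_upper M N X \<beta> \<beta>0"
proof (cases "\<beta> \<le> \<beta>0")
  case True
  then show ?thesis by (simp add: Q_upper_def pressure_le)
next
  case False
  have "pressure M N X \<beta> \<le> pressure M N X \<beta>0 + (\<beta> - \<beta>0) * slope \<beta>"
    using pressure_tangent[of \<beta> \<beta>0] by (simp add: algebra_simps)
  also have "\<dots> \<le> ln 2 + \<beta>0\<^sup>2 / 4 + (\<beta> - \<beta>0) * sqrt (expected_kl M N X \<beta> / real N)"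
    using False by (intro add_mono pressure_le mult_left_mono slope_le_sqrt_expected_kl) simp
  finally show ?thesis using False by (simp add: Q_upper_def)
qed

lemma Q_lower_le_pressure:
  assumes "0 < c" "0 < \<beta>s" "0 \<le> \<beta>"
    and low: "\<And>\<beta>. 0 \<le> \<beta> \<Longrightarrow> \<beta> \<le> \<beta>s \<Longrightarrow> ln 2 + c\<^sup>2 * \<beta>\<^sup>2 / 8 \<le> pressure M N X \<beta>"
  shows "Q_lower c M N X \<beta> \<beta>s \<le> pressure M N X \<beta>"
proof (cases "\<beta> \<le> \<beta>s")
  case True
  then show ?thesis using assms by (simp add: Q_lower_def)
next
  case False
  let ?p = "slope \<beta>s" and ?D = "expected_kl M N X \<beta>s / real N"
  have lows: "ln 2 + c\<^sup>2 * \<beta>s\<^sup>2 / 8 \<le> pressure M N X \<beta>s" using low[of \<beta>s] assms by simp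
  then have p: "0 \<le> ?p"
    by (intro slope_nonneg assms) (smt (verit) zero_le_power2 mult_nonneg_nonneg divide_nonneg_pos)
  have "c\<^sup>2 * (?D / 2) \<le> c\<^sup>2 * ((\<beta>s * ?p - c\<^sup>2 * \<beta>s\<^sup>2 / 8) / 2)"
    using lows unfolding expected_kl_eq by (intro mult_left_mono divide_right_mono) simp_all
  \<comment> \<open>Completing the square; the point \<open>c\<^sup>2 * \<beta>s / 4\<close> is the
    derivative of \<open>c\<^sup>2 * \<beta>\<^sup>2 / 8\<close> at \<open>\<beta>s\<close>.\<close>
  also have "\<dots> = ?p\<^sup>2 - (?p - c\<^sup>2 * \<beta>s / 4)\<^sup>2"
    by (simp add: power2_eq_square field_simps)
  also have "\<dots> \<le> ?p\<^sup>2" by simp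
  finally have "sqrt (c\<^sup>2 * (?D / 2)) \<le> ?p"
    using p by (simp add: real_le_lsqrt)
  then have "c * sqrt (?D / 2) \<le> ?p"
    using assms(1) by (simp only: real_sqrt_mult real_sqrt_abs abs_of_pos)
  then have "(\<beta> - \<beta>s) * (c * sqrt (?D / 2)) \<le> (\<beta> - \<beta>s) * ?p"
    using False by (intro mult_left_mono) simp_all
  then have "ln 2 + c\<^sup>2 * \<beta>s\<^sup>2 / 8 + (\<beta> - \<beta>s) * (c * sqrt (?D / 2)) \<le> pressure M N X \<beta>"
    using lows pressure_tangent[of \<beta>s \<beta>] by linarith
  then show ?thesis using False by (simp add: Q_lower_def mult_ac)
qed

lemma ex_threshold:
  assumes "0 < c" "c < 1"
  shows "\<exists>\<beta>s>0. \<forall>\<beta>. 0 \<le> \<beta> \<longrightarrow> \<beta> \<le> \<beta>s \<longrightarrow> ln 2 + c\<^sup>2 * \<beta>\<^sup>2 / 8 \<le> pressure M N X \<beta>"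
proof (intro exI conjI allI impI)
  \<comment> \<open>The positive solution of \<open>\<beta>\<^sup>2 / 8 - 3 * N * \<beta> ^ 4 / 64 =
    c\<^sup>2 * \<beta>\<^sup>2 / 8\<close>: up to here the quartic error is absorbed by the gap
    between 1 and \<open>c\<^sup>2\<close>.\<close>
  define \<beta>s where "\<beta>s = sqrt (8 * (1 - c\<^sup>2) / (3 * real N))"
  have c2: "c\<^sup>2 < 1" using assms by (simp add: power_less_one_iff)
  then show "0 < \<beta>s" using N_pos by (simp add: \<beta>s_def)
  fix \<beta> assume "0 \<le> \<beta>" "\<beta> \<le> \<beta>s"
  then have "\<beta>\<^sup>2 \<le> \<beta>s\<^sup>2" by (rule power_mono[rotated])
  also have "\<beta>s\<^sup>2 = 8 * (1 - c\<^sup>2) / (3 * real N)"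
    using c2 N_pos by (simp add: \<beta>s_def)
  finally have "3 * real N * \<beta>\<^sup>2 \<le> 8 * (1 - c\<^sup>2)"
    using N_pos by (simp add: field_simps)
  then have "\<beta>\<^sup>2 / 64 * (3 * real N * \<beta>\<^sup>2) \<le> \<beta>\<^sup>2 / 64 * (8 * (1 - c\<^sup>2))"
    by (intro mult_left_mono) simp_all
  then have "ln 2 + c\<^sup>2 * \<beta>\<^sup>2 / 8 \<le> ln 2 + \<beta>\<^sup>2 / 8 - 3 * real N * \<beta> ^ 4 / 64"
    by (simp add: algebra_simps power4_eq_xxxx power2_eq_square)
  also note pressure_ge
  finally show "ln 2 + c\<^sup>2 * \<beta>\<^sup>2 / 8 \<le> pressure M N X \<beta>" .
qed

end

theorem theorem7:
  fixes c :: real and N :: nat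
    and M :: "'a measure" and X :: "(nat \<Rightarrow> int) \<Rightarrow> 'a \<Rightarrow> real"
  assumes "0 < c" and "c < 1" and "sudakov_constant c"
    and "1 \<le> N"
    and "rem_field M N X"
  shows "\<exists>\<beta>s>0. \<forall>\<beta>\<ge>0.
           Q_lower c M N X \<beta> \<beta>s \<le> pressure M N X \<beta> \<and>
           pressure M N X \<beta> \<le> (INF \<beta>0\<in>{0..}. Q_upper M N X \<beta> \<beta>0)"
proof -
  interpret prob_space M
    using assms(5) by (simp add: rem_field_def)
  interpret rem M N X
    by unfold_locales (rule assms)+
  obtain \<beta>s where "0 < \<beta>s"
    and "\<And>\<beta>. 0 \<le> \<beta> \<Longrightarrow> \<beta> \<le> \<beta>s \<Longrightarrow> ln 2 + c\<^sup>2 * \<beta>\<^sup>2 / 8 \<le> pressure M N X \<beta>"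
    using ex_threshold[OF assms(1,2)] by blast
  then have "Q_lower c M N X \<beta> \<beta>s \<le> pressure M N X \<beta>" if "0 \<le> \<beta>" for \<beta>
    using Q_lower_le_pressure[OF assms(1) _ that] by blast
  moreover have "pressure M N X \<beta> \<le> (INF \<beta>0\<in>{0..}. Q_upper M N X \<beta> \<beta>0)" for \<beta>
    \<comment> \<open>The real infimum is over a nonempty family, bounded below by the pressure
      itself.\<close>
    by (rule cINF_greatest) (auto intro: pressure_le_Q_upper)
  ultimately show ?thesis using \<open>0 < \<beta>s\<close> by blast
qed

end
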